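(* Let $k=\mathbb F_q$ and let $E/k$ be an elliptic curve with a faithful action of a finite group $\Lambda$ on $E_{\bar k}$ by curve automorphisms that is stable under $q$-power Frobenius conjugation and whose group of linear parts is nontrivial. Let $\pi:E\to Y:=E/\Lambda$ be the quotient (defined over $k$), $\mathcal F_E$ the $q$-power Frobenius, and for $\gamma\in\Lambda$ put $$\mathcal S_\gamma(E)=\{P\in E(\bar k):\mathcal F_E(P)=\gamma_E(P)\}.$$ Let $Q\in Y(k)$, choose $P\in\pi^{-1}(Q)$, write $\Lambda_P=\operatorname{Stab}_\Lambda(P)$, and for $\gamma\in\Lambda$ put $m_Q(\gamma)=\lvert\mathcal S_\gamma(E)\cap\pi^{-1}(Q)\rvert$. Then every point of the geometric fibre $\pi^{-1}(Q)$ lies in exactly $\lvert\Lambda_P\rvert$ of the sets $\mathcal S_\gamma(E)$, $\gamma\in\Lambda$. Consequently, $$\sum_{\gamma\in\Lambda}m_Q(\gamma)=\lvert\Lambda\rvert .$$ The function $\gamma\mapsto m_Q(\gamma)$ is constant on every $\sim_\vartheta$-class. Thus, for any complete set $\mathcal R$ of representatives for the $\sim_\vartheta$-classes in $\Lambda$, $$\sum_{\gamma\in\mathcal R}\lvert[\gamma]_\vartheta\rvert\,m_Q(\gamma)=\lvert\Lambda\rvert .$$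
   Context: $\bar k$ is an algebraic closure of $k$. Every curve automorphism $\gamma_E$ of $E_{\bar k}$ is uniquely $\gamma_E(P)=u_{\gamma,E}(P)+a_{\gamma,E}$ with $u_{\gamma,E}\in\operatorname{Aut}_{\bar k}(E,\mathrm O_E)$, the linear part. The action is stable under $q$-power Frobenius conjugation if the image of $\Lambda$ in $\operatorname{Aut}_{\bar k}(E)$ is invariant under conjugation by the bijection $\mathcal F_E$ of $E(\bar k)$; then there is a unique $\vartheta\in\operatorname{Aut}(\Lambda)$ with $\vartheta(\gamma)_E=\mathcal F_E\circ\gamma_E\circ\mathcal F_E^{-1}$ on $E(\bar k)$ for all $\gamma\in\Lambda$. The equivalence relation $\sim_\vartheta$ on $\Lambda$ is: $\gamma\sim_\vartheta\eta$ iff $\eta=\vartheta(h)\gamma h^{-1}$ for some $h\in\Lambda$; $[\gamma]_\vartheta$ is the class of $\gamma$. The quotient $Y$ and $\pi$ descend to $k$, and geometric fibres of $\pi$ are single $\Lambda$-orbits. *)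

theory Defs
  imports
    "HOL-Library.Poly_Mapping"
    "HOL-Library.Cardinality"
    "HOL-Algebra.Algebraic_Closure_Type"
    "HOL-Algebra.Group_Action"
begin

section \<open>Projective algebraic sets and morphisms\<close>

text \<open>
  A point of n-dimensional projective space is given by its unique homogeneous coordinate vector
  whose last nonzero coordinate is 1; coordinates with index above n are 0. In the plane these
  are the points [x:y:1], [x:1:0] and [1:0:0]. With this normalisation, a point is rational over
  a subfield iff all its coordinates lie in that subfield, and coordinatewise application of a
  field endomorphism is well defined on points.
\<close>

definition proj_space :: "nat \<Rightarrow> (nat \<Rightarrow> 'b::field) set" where
  "proj_space n = {P. \<exists>i\<le>n. P i = 1 \<and> (\<forall>j>i. P j = 0)}"

text \<open>Polynomials in variables indexed by natural numbers are finitely supported maps from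
  monomials (finitely supported exponent vectors) to coefficients.\<close>

type_synonym 'b mpoly = "(nat \<Rightarrow>\<^sub>0 nat) \<Rightarrow>\<^sub>0 'b"

definition peval :: "'b::field mpoly \<Rightarrow> (nat \<Rightarrow> 'b) \<Rightarrow> 'b" where
  "peval p x = (\<Sum>m\<in>Poly_Mapping.keys p. Poly_Mapping.lookup p m *
     (\<Prod>i\<in>Poly_Mapping.keys m. x i ^ Poly_Mapping.lookup m i))"

text \<open>\<open>forms A n d\<close>: forms of degree d in the variables 0, ..., n with coefficients in A,
  including the zero polynomial.\<close>

definition forms :: "'b::field set \<Rightarrow> nat \<Rightarrow> nat \<Rightarrow> 'b mpoly set" where
  "forms A n d = {p. \<forall>m\<in>Poly_Mapping.keys p. Poly_Mapping.lookup p m \<in> A \<and>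
     Poly_Mapping.keys m \<subseteq> {..n} \<and>
     (\<Sum>i\<in>Poly_Mapping.keys m. Poly_Mapping.lookup m i) = d}"

definition algebraic_set :: "'b::field set \<Rightarrow> nat \<Rightarrow> (nat \<Rightarrow> 'b) set \<Rightarrow> bool" where
  "algebraic_set A n V \<longleftrightarrow>
     (\<exists>S \<subseteq> (\<Union>d. forms A n d). V = {P \<in> proj_space n. \<forall>F\<in>S. peval F P = 0})"

definition zariski_open :: "nat \<Rightarrow> (nat \<Rightarrow> 'b::field) set \<Rightarrow> (nat \<Rightarrow> 'b) set \<Rightarrow> bool" where
  "zariski_open n V U \<longleftrightarrow>
     (\<exists>S \<subseteq> (\<Union>d. forms UNIV n d). U = {P \<in> V. \<exists>F\<in>S. peval F P \<noteq> 0})"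

definition regular_on :: "nat \<Rightarrow> (nat \<Rightarrow> 'b::field) set \<Rightarrow> ((nat \<Rightarrow> 'b) \<Rightarrow> 'b) \<Rightarrow> bool" where
  "regular_on n U f \<longleftrightarrow>
     (\<forall>P\<in>U. \<exists>d. \<exists>G\<in>forms UNIV n d. \<exists>H\<in>forms UNIV n d. peval H P \<noteq> 0 \<and>
        (\<forall>R\<in>U. peval H R \<noteq> 0 \<longrightarrow> f R = peval G R / peval H R))"

text \<open>
  \<open>proj_morphism A m V n Y f\<close>: near every point of V the map f is of the form
  P \<open>\<mapsto>\<close> [F 0(P) : ... : F n(P)] for forms F i of equal degree with coefficients in A, and
  represents f wherever these forms do not vanish simultaneously. For perfect subfields A of an
  algebraically closed field over which V and Y are defined, these are the morphisms over A.
\<close>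

definition proj_morphism ::
  "'b::field set \<Rightarrow> nat \<Rightarrow> (nat \<Rightarrow> 'b) set \<Rightarrow> nat \<Rightarrow> (nat \<Rightarrow> 'b) set \<Rightarrow>
    ((nat \<Rightarrow> 'b) \<Rightarrow> (nat \<Rightarrow> 'b)) \<Rightarrow> bool" where
  "proj_morphism A m V n Y f \<longleftrightarrow> f ` V \<subseteq> Y \<and>
     (\<forall>P\<in>V. \<exists>d F. (\<forall>i\<le>n. F i \<in> forms A m d) \<and> (\<exists>i\<le>n. peval (F i) P \<noteq> 0) \<and>
        (\<forall>R\<in>V. (\<exists>i\<le>n. peval (F i) R \<noteq> 0) \<longrightarrow>
           (\<exists>c. c \<noteq> 0 \<and> (\<forall>i\<le>n. peval (F i) R = c * f R i))))"

definition proj_automorphisms ::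
  "nat \<Rightarrow> (nat \<Rightarrow> 'b::field) set \<Rightarrow> ((nat \<Rightarrow> 'b) \<Rightarrow> (nat \<Rightarrow> 'b)) set" where
  "proj_automorphisms n V =
     {f \<in> Bij V. proj_morphism UNIV n V n V f \<and>
        proj_morphism UNIV n V n V (restrict (inv_into V f) V)}"

text \<open>
  Geometric quotient of V by G: the fibres are the orbits, Y carries the quotient topology, and
  the structure sheaf of Y is the sheaf of invariants. The last condition uses that, the fibres
  being the orbits, the invariant functions on the preimage of U are those of the form f o p.
\<close>

definition geometric_quotient ::
  "nat \<Rightarrow> (nat \<Rightarrow> 'b::field) set \<Rightarrow> ('g, 'm) monoid_scheme \<Rightarrow>
    ('g \<Rightarrow> (nat \<Rightarrow> 'b) \<Rightarrow> (nat \<Rightarrow> 'b)) \<Rightarrow> nat \<Rightarrow> (nat \<Rightarrow> 'b) set \<Rightarrow>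
    ((nat \<Rightarrow> 'b) \<Rightarrow> (nat \<Rightarrow> 'b)) \<Rightarrow> bool" where
  "geometric_quotient m V G \<phi> n Y p \<longleftrightarrow>
     proj_morphism UNIV m V n Y p \<and> p ` V = Y \<and>
     (\<forall>P\<in>V. {R \<in> V. p R = p P} = orbit G \<phi> P) \<and>
     (\<forall>U\<subseteq>Y. zariski_open n Y U \<longleftrightarrow> zariski_open m V {P \<in> V. p P \<in> U}) \<and>
     (\<forall>U f. zariski_open n Y U \<longrightarrow>
        (regular_on n U f \<longleftrightarrow> regular_on m {P \<in> V. p P \<in> U} (f \<circ> p)))"


section \<open>Elliptic curves\<close>

text \<open>Generalised Weierstrass equations
  \<open>y\<^sup>2 + a1 x y + a3 y = x\<^sup>3 + a2 x\<^sup>2 + a4 x + a6\<close>, valid in every characteristic.\<close>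

record 'b weierstrass =
  wa1 :: 'b
  wa2 :: 'b
  wa3 :: 'b
  wa4 :: 'b
  wa6 :: 'b

definition discriminant :: "'b::field weierstrass \<Rightarrow> 'b" where
  "discriminant W =
    (let a1 = wa1 W; a2 = wa2 W; a3 = wa3 W; a4 = wa4 W; a6 = wa6 W;
         b2 = a1^2 + 4 * a2; b4 = 2 * a4 + a1 * a3; b6 = a3^2 + 4 * a6;
         b8 = a1^2 * a6 + 4 * a2 * a6 - a1 * a3 * a4 + a2 * a3^2 - a4^2
     in - (b2^2 * b8) - 8 * b4^3 - 27 * b6^2 + 9 * b2 * b4 * b6)"

definition elliptic_curve :: "'b::field weierstrass \<Rightarrow> bool" where
  "elliptic_curve W \<longleftrightarrow> discriminant W \<noteq> 0"

definition base_change :: "'a::field weierstrass \<Rightarrow> 'a alg_closure weierstrass" where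
  "base_change W = \<lparr>wa1 = to_ac (wa1 W), wa2 = to_ac (wa2 W), wa3 = to_ac (wa3 W),
     wa4 = to_ac (wa4 W), wa6 = to_ac (wa6 W)\<rparr>"

definition ec_points :: "'b::field weierstrass \<Rightarrow> (nat \<Rightarrow> 'b) set" where
  "ec_points W = {P \<in> proj_space 2. let x = P 0; y = P 1; z = P 2 in
     y^2 * z + wa1 W * x * y * z + wa3 W * y * z^2 =
     x^3 + wa2 W * x^2 * z + wa4 W * x * z^2 + wa6 W * z^3}"

definition ec_affine :: "'b::field \<Rightarrow> 'b \<Rightarrow> nat \<Rightarrow> 'b" where
  "ec_affine x y = (\<lambda>_. 0)(0 := x, 1 := y, 2 := 1)"

definition ec_zero :: "nat \<Rightarrow> 'b::field" where
  "ec_zero = (\<lambda>_. 0)(1 := 1)"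

text \<open>Chord-tangent addition; \<open>y = l x + v\<close> is the chord, or the tangent for a doubling.\<close>

definition ec_add :: "'b::field weierstrass \<Rightarrow> (nat \<Rightarrow> 'b) \<Rightarrow> (nat \<Rightarrow> 'b) \<Rightarrow> nat \<Rightarrow> 'b" where
  "ec_add W P Q =
    (if P = ec_zero then Q else if Q = ec_zero then P else
     let a1 = wa1 W; a2 = wa2 W; a3 = wa3 W; a4 = wa4 W;
         x1 = P 0; y1 = P 1; x2 = Q 0; y2 = Q 1
     in if x1 = x2 \<and> y1 + y2 + a1 * x2 + a3 = 0 then ec_zero else
     let l = (if x1 = x2
              then (3 * x1^2 + 2 * a2 * x1 + a4 - a1 * y1) / (2 * y1 + a1 * x1 + a3)
              else (y2 - y1) / (x2 - x1));
         v = y1 - l * x1;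
         x3 = l^2 + a1 * l - a2 - x1 - x2
     in ec_affine x3 (- (l + a1) * x3 - v - a3))"

definition ec_automorphisms ::
  "'b::field weierstrass \<Rightarrow> ((nat \<Rightarrow> 'b) \<Rightarrow> (nat \<Rightarrow> 'b)) set" where
  "ec_automorphisms W = proj_automorphisms 2 (ec_points W)"

text \<open>For an automorphism of an elliptic curve over an algebraically closed field, the description
  below determines a unique map.\<close>

definition linear_part ::
  "'b::field weierstrass \<Rightarrow> ((nat \<Rightarrow> 'b) \<Rightarrow> (nat \<Rightarrow> 'b)) \<Rightarrow> ((nat \<Rightarrow> 'b) \<Rightarrow> (nat \<Rightarrow> 'b))" where
  "linear_part W \<sigma> = (THE u. u \<in> ec_automorphisms W \<and> u ec_zero = ec_zero \<and>
     (\<exists>a\<in>ec_points W. \<forall>P\<in>ec_points W. \<sigma> P = ec_add W (u P) a))"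


section \<open>Frobenius\<close>

definition frob :: "(nat \<Rightarrow> 'a::{field,finite} alg_closure) \<Rightarrow> nat \<Rightarrow> 'a alg_closure" where
  "frob P = (\<lambda>i. P i ^ CARD('a))"

definition rational_points ::
  "(nat \<Rightarrow> 'a::field alg_closure) set \<Rightarrow> (nat \<Rightarrow> 'a alg_closure) set" where
  "rational_points Y = {Q \<in> Y. \<forall>i. Q i \<in> range to_ac}"

definition frob_conj ::
  "(nat \<Rightarrow> 'a::{field,finite} alg_closure) set \<Rightarrow>
    ((nat \<Rightarrow> 'a alg_closure) \<Rightarrow> (nat \<Rightarrow> 'a alg_closure)) \<Rightarrow>
    (nat \<Rightarrow> 'a alg_closure) \<Rightarrow> (nat \<Rightarrow> 'a alg_closure)" where
  "frob_conj V \<sigma> = (\<lambda>P\<in>V. frob (\<sigma> (inv_into V frob P)))"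

definition frob_stable ::
  "(nat \<Rightarrow> 'a::{field,finite} alg_closure) set \<Rightarrow> ('g, 'm) monoid_scheme \<Rightarrow>
    ('g \<Rightarrow> (nat \<Rightarrow> 'a alg_closure) \<Rightarrow> (nat \<Rightarrow> 'a alg_closure)) \<Rightarrow> bool" where
  "frob_stable V G \<phi> \<longleftrightarrow> frob_conj V ` (\<phi> ` carrier G) = \<phi> ` carrier G"

text \<open>For a faithful Frobenius-stable action there is exactly one such automorphism
  (elements of \<open>auto G\<close> are extensional on the carrier).\<close>

definition frob_twist ::
  "(nat \<Rightarrow> 'a::{field,finite} alg_closure) set \<Rightarrow> ('g, 'm) monoid_scheme \<Rightarrow>
    ('g \<Rightarrow> (nat \<Rightarrow> 'a alg_closure) \<Rightarrow> (nat \<Rightarrow> 'a alg_closure)) \<Rightarrow> 'g \<Rightarrow> 'g" where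
  "frob_twist V G \<phi> =
     (THE \<theta>. \<theta> \<in> auto G \<and> (\<forall>\<gamma>\<in>carrier G. \<phi> (\<theta> \<gamma>) = frob_conj V (\<phi> \<gamma>)))"

definition frob_points ::
  "(nat \<Rightarrow> 'a::{field,finite} alg_closure) set \<Rightarrow>
    ('g \<Rightarrow> (nat \<Rightarrow> 'a alg_closure) \<Rightarrow> (nat \<Rightarrow> 'a alg_closure)) \<Rightarrow> 'g \<Rightarrow>
    (nat \<Rightarrow> 'a alg_closure) set" where
  "frob_points V \<phi> \<gamma> = {P \<in> V. frob P = \<phi> \<gamma> P}"

definition fibre :: "'p set \<Rightarrow> ('p \<Rightarrow> 'p) \<Rightarrow> 'p \<Rightarrow> 'p set" where
  "fibre V p Q = {P \<in> V. p P = Q}"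

definition fibre_count ::
  "(nat \<Rightarrow> 'a::{field,finite} alg_closure) set \<Rightarrow>
    ('g \<Rightarrow> (nat \<Rightarrow> 'a alg_closure) \<Rightarrow> (nat \<Rightarrow> 'a alg_closure)) \<Rightarrow>
    ((nat \<Rightarrow> 'a alg_closure) \<Rightarrow> (nat \<Rightarrow> 'a alg_closure)) \<Rightarrow>
    (nat \<Rightarrow> 'a alg_closure) \<Rightarrow> 'g \<Rightarrow> nat" where
  "fibre_count V \<phi> p Q \<gamma> = card (frob_points V \<phi> \<gamma> \<inter> fibre V p Q)"


section \<open>Twisted conjugacy\<close>

definition twisted_conj :: "('g, 'm) monoid_scheme \<Rightarrow> ('g \<Rightarrow> 'g) \<Rightarrow> ('g \<times> 'g) set" where
  "twisted_conj G \<theta> = {(\<gamma>, \<eta>). \<gamma> \<in> carrier G \<and> \<eta> \<in> carrier G \<and>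
     (\<exists>h\<in>carrier G. \<eta> = \<theta> h \<otimes>\<^bsub>G\<^esub> \<gamma> \<otimes>\<^bsub>G\<^esub> inv\<^bsub>G\<^esub> h)}"

definition complete_reps :: "'g set \<Rightarrow> ('g \<times> 'g) set \<Rightarrow> 'g set \<Rightarrow> bool" where
  "complete_reps A r R \<longleftrightarrow> R \<subseteq> A \<and> (\<forall>C \<in> A // r. \<exists>!\<gamma>. \<gamma> \<in> R \<inter> C)"

end

theory Submission
  imports Defs
begin

text \<open>
  Since \<open>\<pi>\<close> is defined over k and Q is rational, the Frobenius maps the fibre over Q to itself.
  The fibre is a single orbit, so for each R in it the elements \<open>\<gamma>\<close> with \<open>frob R = \<gamma> R\<close> form a
  coset of the stabilizer of R, which is conjugate to that of P. Counting the pairs \<open>(\<gamma>, R)\<close> and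
  the orbit-stabilizer theorem give the total, and R \<open>\<mapsto>\<close> h R identifies the points counted for
  twisted conjugate elements.
\<close>

section \<open>The q-power map on the algebraic closure of a field with q elements\<close>

text \<open>Multiplication by a nonzero \<open>x\<close> permutes the nonzero elements. Comparing
  the product of all of them before and after gives exponent q - 1 for the units.\<close>

lemma power_CARD_eq_self:
  fixes x :: "'a::{field,finite}"
  shows "x ^ CARD('a) = x"
proof (cases "x = 0")
  case True
  then show ?thesis by (simp add: zero_power)
next
  case False
  let ?U = "UNIV - {0 :: 'a}"
  have "bij_betw ((*) x) ?U ?U"
    by (rule bij_betw_byWitness[where f' = "\<lambda>y. y / x"]) (use False in auto)
  then have "\<Prod>?U = (\<Prod>y\<in>?U. x * y)"
    using prod.reindex_bij_betw[of "(*) x" ?U ?U "\<lambda>y. y"] by simp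
  also have "\<dots> = x ^ (CARD('a) - 1) * \<Prod>?U"
    by (simp add: prod.distrib)
  finally have "x ^ (CARD('a) - 1) = 1"
    by simp
  then show ?thesis
    using power_minus_mult[of "CARD('a)" x] by simp
qed

text \<open>
  The polynomials \<open>(1 + X)\<^sup>q\<close> and \<open>1 + X\<^sup>q\<close> agree on all q elements of the field and have the
  same leading coefficient, so they are equal; hence the inner binomial coefficients vanish.
\<close>

lemma of_nat_CARD_choose:
  assumes "0 < i" "i < CARD('a::{field,finite})"
  shows "of_nat (CARD('a) choose i) = (0 :: 'a)"
proof -
  let ?q = "CARD('a)"
  have "[:1, 1 :: 'a:] ^ ?q = 1 + monom 1 ?q"
  proof (rule poly_eqI_degree_lead_coeff[where A = UNIV and n = ?q])
    show "coeff ([:1, 1 :: 'a:] ^ ?q) ?q = coeff (1 + monom 1 ?q) ?q"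
      using coeff_linear_poly_power[of ?q ?q "1 :: 'a" 1] by simp
    show "degree ([:1, 1 :: 'a:] ^ ?q) \<le> ?q"
      using degree_power_le[of "[:1, 1 :: 'a:]" ?q] by simp
    show "degree (1 + monom (1 :: 'a) ?q) \<le> ?q"
      by (intro degree_add_le degree_monom_le) simp
  qed (simp_all add: poly_power poly_monom power_CARD_eq_self)
  then show ?thesis
    using assms coeff_linear_poly_power[of i ?q "1 :: 'a" 1] by simp
qed

lemma power_CARD_add:
  fixes x y :: "'a::{field,finite} alg_closure"
  shows "(x + y) ^ CARD('a) = x ^ CARD('a) + y ^ CARD('a)"
proof -
  let ?q = "CARD('a)" and ?f = "\<lambda>k. of_nat (CARD('a) choose k) * x ^ k * y ^ (CARD('a) - k)"
  have "?f k = 0" if "k \<in> {..?q} - {0, ?q}" for k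
  proof -
    \<comment> \<open>The binomial coefficient vanishes in the base field; \<open>to_ac\<close>
      carries this to the closure.\<close>
    have "to_ac (of_nat (?q choose k) :: 'a) = 0"
      using that by (subst of_nat_CARD_choose) auto
    then show ?thesis by simp
  qed
  then have "(\<Sum>k\<le>?q. ?f k) = (\<Sum>k\<in>{0, ?q}. ?f k)"
    by (intro sum.mono_neutral_right) auto
  then show ?thesis
    by (simp add: binomial_ring add.commute)
qed

lemma power_CARD_sum:
  fixes f :: "'i \<Rightarrow> 'a::{field,finite} alg_closure"
  shows "(\<Sum>i\<in>A. f i) ^ CARD('a) = (\<Sum>i\<in>A. f i ^ CARD('a))"
  by (induction A rule: infinite_finite_induct) (simp_all add: power_CARD_add zero_power)

lemma power_CARD_to_ac: "to_ac (a :: 'a::{field,finite}) ^ CARD('a) = to_ac a"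
  by (simp add: power_CARD_eq_self flip: to_ac_power)

text \<open>By additivity the q-th power of \<open>x - y\<close> is the difference of the q-th
  powers, and a field has no nonzero nilpotents.\<close>

lemma power_CARD_inject:
  fixes x y :: "'a::{field,finite} alg_closure"
  shows "x ^ CARD('a) = y ^ CARD('a) \<longleftrightarrow> x = y"
proof
  assume "x ^ CARD('a) = y ^ CARD('a)"
  then have "(x - y) ^ CARD('a) = 0"
    using power_CARD_add[of "x - y" y] by simp
  then show "x = y" by simp
qed simp

lemma power_CARD_surj:
  fixes y :: "'a::{field,finite} alg_closure"
  obtains x where "x ^ CARD('a) = y"
proof -
  have "\<exists>x. poly (monom 1 CARD('a) - [:y:]) x = 0"
  proof (rule alg_closed_imp_poly_has_root)
    show "degree (monom 1 CARD('a) - [:y:]) > 0"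
      \<comment> \<open>The coefficient at q is 1, since the constant \<open>y\<close> does not
        reach that degree; so the degree is at least q, which is positive.\<close>
      by (rule less_le_trans[OF _ le_degree[of _ "CARD('a)"]])
        (simp_all add: coeff_pCons split: nat.split)
  qed
  then show thesis
    using that by (auto simp: poly_monom)
qed

section \<open>Frobenius on projective points and on the curve\<close>

lemma inj_frob: "inj (frob :: (nat \<Rightarrow> 'a::{field,finite} alg_closure) \<Rightarrow> _)"
  by (rule injI) (simp add: frob_def fun_eq_iff power_CARD_inject)

lemma surj_frob: "surj (frob :: (nat \<Rightarrow> 'a::{field,finite} alg_closure) \<Rightarrow> _)"
proof (rule surjI)
  fix P :: "nat \<Rightarrow> 'a alg_closure"
  show "frob (\<lambda>i. SOME x. x ^ CARD('a) = P i) = P"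
    unfolding frob_def by (rule ext) (metis (mono_tags) power_CARD_surj someI_ex)
qed

lemma frob_rational_points: "Q \<in> rational_points Y \<Longrightarrow> frob Q = Q"
proof (rule ext)
  fix i
  assume "Q \<in> rational_points Y"
  then obtain a where "Q i = to_ac a"
    unfolding rational_points_def by blast
  then show "frob Q i = Q i"
    by (simp add: frob_def power_CARD_to_ac)
qed

text \<open>The normalisation only asks which coordinates are 0 or 1, and a q-th power is 0 or 1
  exactly when its base is.\<close>

lemma frob_in_proj_space_iff:
  "frob P \<in> proj_space n \<longleftrightarrow> (P :: nat \<Rightarrow> 'a::{field,finite} alg_closure) \<in> proj_space n"
  using power_CARD_inject[where ?'a = 'a and y = 1] by (simp add: proj_space_def frob_def)

text \<open>The coefficients of the equation are fixed by the q-power map, so each side evaluated at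
  \<open>frob P\<close> is the q-th power of its value at \<open>P\<close>. Injectivity of the
  q-power map gives both directions.\<close>

lemma frob_in_ec_points_iff:
  fixes W :: "'a::{field,finite} weierstrass"
  shows "frob P \<in> ec_points (base_change W) \<longleftrightarrow> P \<in> ec_points (base_change W)"
proof -
  let ?V = "base_change W" and ?q = "CARD('a)"
  define l where "l x y z = y^2 * z + wa1 ?V * x * y * z + wa3 ?V * y * z^2" for x y z :: "'a alg_closure"
  define r where "r x y z = x^3 + wa2 ?V * x^2 * z + wa4 ?V * x * z^2 + wa6 ?V * z^3" for x y z :: "'a alg_closure"
  have comm: "(x ^ m) ^ ?q = (x ^ ?q) ^ m" for x :: "'a alg_closure" and m
    by (simp add: mult.commute flip: power_mult)
  have "l x y z ^ ?q = l (x ^ ?q) (y ^ ?q) (z ^ ?q)"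
    and "r x y z ^ ?q = r (x ^ ?q) (y ^ ?q) (z ^ ?q)" for x y z
    by (simp_all only: l_def r_def base_change_def weierstrass.simps power_CARD_add
        power_mult_distrib power_CARD_to_ac comm)
  then have "l (x ^ ?q) (y ^ ?q) (z ^ ?q) = r (x ^ ?q) (y ^ ?q) (z ^ ?q) \<longleftrightarrow> l x y z = r x y z" for x y z
    by (metis power_CARD_inject)
  moreover have "R \<in> ec_points ?V \<longleftrightarrow> R \<in> proj_space 2 \<and> l (R 0) (R 1) (R 2) = r (R 0) (R 1) (R 2)" for R
    by (simp add: ec_points_def Let_def l_def r_def)
  moreover have "frob P i = P i ^ ?q" for i
    by (simp add: frob_def)
  ultimately show ?thesis
    by (simp add: frob_in_proj_space_iff)
qed

lemma bij_betw_frob_ec_points: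
  "bij_betw frob (ec_points (base_change W)) (ec_points (base_change W))"
proof (rule bij_betw_imageI)
  show "inj_on frob (ec_points (base_change W))"
    using inj_frob inj_on_subset by blast
  show "frob ` ec_points (base_change W) = ec_points (base_change W)"
  proof (intro equalityI subsetI)
    fix P
    assume P: "P \<in> ec_points (base_change W)"
    \<comment> \<open>A preimage is taken among all coordinate vectors; the equivalence above then
      places it on the curve.\<close>
    obtain R where "P = frob R"
      using surj_frob by blast
    then show "P \<in> frob ` ec_points (base_change W)"
      using P frob_in_ec_points_iff by blast
  qed (auto simp: frob_in_ec_points_iff)
qed

section \<open>Frobenius and morphisms over the base field\<close>

lemma peval_frob:
  fixes F :: "'a::{field,finite} alg_closure mpoly"
  assumes "F \<in> forms (range to_ac) n d"
  shows "peval F (frob P) = peval F P ^ CARD('a)"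
proof -
  have "Poly_Mapping.lookup F m ^ CARD('a) = Poly_Mapping.lookup F m"
    if "m \<in> Poly_Mapping.keys F" for m
    using assms that power_CARD_to_ac unfolding forms_def by fastforce
  then show ?thesis
    by (simp add: peval_def frob_def power_CARD_sum power_mult_distrib prod_power_distrib
        mult.commute flip: power_mult)
qed

text \<open>Proportional vectors have their last nonzero coordinate at the same index. Normalisation
  makes it 1 in both, which forces \<open>c = 1\<close>.\<close>

lemma proj_space_scale_eq:
  assumes P: "P \<in> proj_space n" and Q: "Q \<in> proj_space n"
    and "c \<noteq> 0" and PQ: "\<And>i. i \<le> n \<Longrightarrow> P i = c * Q i"
  shows "P = Q"
proof -
  obtain i where i: "i \<le> n" "P i = 1" "\<And>j. j > i \<Longrightarrow> P j = 0"
    using P by (auto simp: proj_space_def)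
  obtain k where k: "k \<le> n" "Q k = 1" "\<And>j. j > k \<Longrightarrow> Q j = 0"
    using Q by (auto simp: proj_space_def)
  have "i = k"
    using i k PQ[of i] PQ[of k] \<open>c \<noteq> 0\<close> by (cases i k rule: linorder_cases) auto
  then have "c = 1"
    using PQ[of k] i k by simp
  show ?thesis
  proof
    fix j
    show "P j = Q j"
      using PQ[of j] i k \<open>c = 1\<close> by (cases "j \<le> n") auto
  qed
qed

text \<open>Forms over the base field that represent \<open>f\<close> near \<open>P\<close> take
  q-th powers of their values at \<open>P\<close> as values at \<open>frob P\<close>. Hence they do
  not all vanish there either, and the same forms compute \<open>f\<close> at both points, up to a
  scalar.\<close>

lemma proj_morphism_frob:
  fixes f :: "(nat \<Rightarrow> 'a::{field,finite} alg_closure) \<Rightarrow> (nat \<Rightarrow> 'a alg_closure)"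
  assumes f: "proj_morphism (range to_ac) m V n Y f" and Y: "Y \<subseteq> proj_space n"
    and P: "P \<in> V" "frob P \<in> V"
  shows "f (frob P) = frob (f P)"
proof -
  obtain d F where F: "\<And>i. i \<le> n \<Longrightarrow> F i \<in> forms (range to_ac) m d"
    and nz: "\<exists>i\<le>n. peval (F i) P \<noteq> 0"
    and rep: "\<forall>R\<in>V. (\<exists>i\<le>n. peval (F i) R \<noteq> 0) \<longrightarrow>
      (\<exists>c. c \<noteq> 0 \<and> (\<forall>i\<le>n. peval (F i) R = c * f R i))"
    using f P(1) unfolding proj_morphism_def by blast
  have F_frob: "peval (F i) (frob P) = peval (F i) P ^ CARD('a)" if "i \<le> n" for i
    using F[OF that] by (rule peval_frob)
  obtain c where c: "c \<noteq> 0" "\<And>i. i \<le> n \<Longrightarrow> peval (F i) P = c * f P i"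
    using rep P(1) nz by blast
  have "\<exists>i\<le>n. peval (F i) (frob P) \<noteq> 0"
    using nz F_frob by auto
  with rep P(2) obtain c'
    where c': "c' \<noteq> 0" "\<And>i. i \<le> n \<Longrightarrow> peval (F i) (frob P) = c' * f (frob P) i"
    by blast
  show ?thesis
  proof (rule proj_space_scale_eq)
    show "f (frob P) \<in> proj_space n" "frob (f P) \<in> proj_space n"
      using f Y P by (auto simp: proj_morphism_def frob_in_proj_space_iff)
    show "c ^ CARD('a) / c' \<noteq> 0"
      using c c' by simp
    show "f (frob P) i = c ^ CARD('a) / c' * frob (f P) i" if "i \<le> n" for i
      using c'(1) c'(2)[OF that] F_frob[OF that] c(2)[OF that]
      by (simp add: frob_def field_simps)
  qed
qed

section \<open>Counting in orbits\<close>

lemma (in group_action) act_inv_act: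
  assumes "g \<in> carrier G" "x \<in> E"
  shows "\<phi> (inv g) (\<phi> g x) = x"
  using orbit_sym_aux[OF assms refl] .

lemma (in group_action) orbit_eq:
  assumes "x \<in> E" "y \<in> orbit G \<phi> x"
  shows "orbit G \<phi> y = orbit G \<phi> x"
proof -
  have sub: "orbit G \<phi> z \<subseteq> E" if "z \<in> E" for z
    using that element_image by (auto simp: orbit_def)
  have "y \<in> E"
    using sub assms by blast
  then show ?thesis
    using assms sub orbit_sym orbit_trans by (meson subsetD subsetI subset_antisym)
qed

text \<open>The two points share one orbit, so the orbit-stabilizer theorem gives the same product
  for both, and the orbit size cancels.\<close>

lemma (in group_action) card_stabilizer_orbit:
  assumes "finite (carrier G)" "x \<in> E" "y \<in> orbit G \<phi> x"
  shows "card (stabilizer G \<phi> y) = card (stabilizer G \<phi> x)"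
proof -
  interpret G: group G
    using group_hom by (simp add: group_hom_def)
  have "y \<in> E"
    using assms element_image by (auto simp: orbit_def)
  then have "card (orbit G \<phi> x) * card (stabilizer G \<phi> y) =
      card (orbit G \<phi> x) * card (stabilizer G \<phi> x)"
    using orbit_stabilizer_theorem[OF assms(2)] orbit_stabilizer_theorem[of y]
      orbit_eq[OF assms(2,3)] by simp
  \<comment> \<open>This size divides the order of the group, which is positive because the group is
    finite.\<close>
  moreover have "card (orbit G \<phi> x) \<noteq> 0"
    using orbit_stabilizer_theorem[OF \<open>x \<in> E\<close>] G.order_gt_0_iff_finite assms(1)
    by (metis less_irrefl mult_0)
  ultimately show ?thesis by simp
qed

text \<open>If \<open>g\<close> sends \<open>x\<close> to \<open>y\<close>, the elements doing so
  form the left coset of the stabilizer of \<open>x\<close> by \<open>g\<close>.\<close>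

lemma (in group_action) card_transporter:
  assumes x: "x \<in> E" and y: "y \<in> orbit G \<phi> x"
  shows "card {g \<in> carrier G. \<phi> g x = y} = card (stabilizer G \<phi> x)"
proof -
  interpret G: group G
    using group_hom by (simp add: group_hom_def)
  obtain g where g: "g \<in> carrier G" "y = \<phi> g x"
    using y by (auto simp: orbit_def)
  have "bij_betw ((\<otimes>) g) (stabilizer G \<phi> x) {h \<in> carrier G. \<phi> h x = y}"
    by (rule bij_betw_byWitness[where f' = "(\<otimes>) (inv g)"])
      (use g x in \<open>auto simp: stabilizer_def composition_rule act_inv_act G.inv_solve_left
        simp flip: G.m_assoc\<close>)
  then show ?thesis
    using bij_betw_same_card by fastforce
qed

text \<open>Double counting of the pairs \<open>(g, y)\<close> with \<open>F y = \<phi> g y\<close>: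
  each \<open>y\<close> contributes a transporter from \<open>y\<close> to \<open>F y\<close>, whose
  size is that of the stabilizer of \<open>x\<close>. The map \<open>F\<close> will be Frobenius on
  a fibre.\<close>

lemma (in group_action) sum_card_coincidences:
  assumes fin: "finite (carrier G)" and x: "x \<in> E"
    and F: "\<And>y. y \<in> orbit G \<phi> x \<Longrightarrow> F y \<in> orbit G \<phi> x"
  shows "(\<Sum>g\<in>carrier G. card {y \<in> orbit G \<phi> x. F y = \<phi> g y}) = card (carrier G)"
proof -
  have "card {g \<in> carrier G. F y = \<phi> g y} = card (stabilizer G \<phi> x)" if y: "y \<in> orbit G \<phi> x" for y
  proof -
    have "y \<in> E"
      using x y element_image by (auto simp: orbit_def)
    moreover have "F y \<in> orbit G \<phi> y"
      using F y orbit_eq[OF x y] by simp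
    ultimately show ?thesis
      using card_transporter[of y "F y"] card_stabilizer_orbit[OF fin x y] by (simp add: eq_commute)
  qed
  moreover have "finite (orbit G \<phi> x)"
    using fin by (simp add: orbit_def)
  ultimately have "(\<Sum>g\<in>carrier G. card {y \<in> orbit G \<phi> x. F y = \<phi> g y}) =
      card (stabilizer G \<phi> x) * card (orbit G \<phi> x)"
    using fin by (intro sum_multicount) auto
  also have "\<dots> = card (carrier G)"
    using orbit_stabilizer_theorem[OF x] by (simp add: Coset.order_def mult.commute)
  finally show ?thesis .
qed

text \<open>The element h maps the solutions x of \<open>F x = \<gamma> x\<close> onto those of
  \<open>F x = \<theta>(h) \<gamma> h\<^sup>-\<^sup>1 x\<close>.\<close>

lemma (in group_action) card_coincidences_twisted_conj:
  assumes "\<theta> \<in> carrier G \<rightarrow> carrier G" and "S \<subseteq> E"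
    and S: "\<And>g x. g \<in> carrier G \<Longrightarrow> x \<in> S \<Longrightarrow> \<phi> g x \<in> S"
    and F: "F \<in> E \<rightarrow> E" "\<And>g x. g \<in> carrier G \<Longrightarrow> x \<in> E \<Longrightarrow> F (\<phi> g x) = \<phi> (\<theta> g) (F x)"
    and conj: "(\<gamma>, \<eta>) \<in> twisted_conj G \<theta>"
  shows "card {x \<in> S. F x = \<phi> \<gamma> x} = card {x \<in> S. F x = \<phi> \<eta> x}"
proof -
  interpret G: group G
    using group_hom by (simp add: group_hom_def)
  obtain h where h: "h \<in> carrier G" and \<gamma>: "\<gamma> \<in> carrier G" and \<eta>: "\<eta> = \<theta> h \<otimes> \<gamma> \<otimes> inv h"
    using conj by (auto simp: twisted_conj_def)
  have [simp]: "\<theta> h \<in> carrier G"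
    using assms(1) h by auto
  have E: "\<And>x. x \<in> S \<Longrightarrow> x \<in> E"
    "\<And>g x. g \<in> carrier G \<Longrightarrow> x \<in> S \<Longrightarrow> \<phi> g x \<in> E"
    using \<open>S \<subseteq> E\<close> S by auto
  have act_\<eta>: "\<phi> \<eta> (\<phi> h x) = \<phi> (\<theta> h) (\<phi> \<gamma> x)" if "x \<in> S" for x
    using that h \<gamma> by (simp add: \<eta> composition_rule E act_inv_act)
  \<comment> \<open>Both sides are images under \<open>\<theta> h\<close>: the left by the
    equivariance of \<open>F\<close>, the right by \<open>act_\<eta>\<close>. As
    \<open>\<theta> h\<close> acts injectively, it cancels.\<close>
  have *: "F (\<phi> h x) = \<phi> \<eta> (\<phi> h x) \<longleftrightarrow> F x = \<phi> \<gamma> x" if "x \<in> S" for x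
    using that h \<gamma> F inj_on_eq_iff[OF inj_prop[of "\<theta> h"], of "F x" "\<phi> \<gamma> x"]
      funcset_mem[OF F(1) E(1)] by (simp add: act_\<eta> E)
  have inv: "\<phi> (inv h) (\<phi> h x) = x" "\<phi> h (\<phi> (inv h) x) = x" if "x \<in> S" for x
    using that h act_inv_act[of h x] act_inv_act[of "inv h" x] by (simp_all add: E)
  have "bij_betw (\<phi> h) {x \<in> S. F x = \<phi> \<gamma> x} {x \<in> S. F x = \<phi> \<eta> x}"
  proof (rule bij_betw_byWitness[where f' = "\<phi> (inv h)"])
    show "\<phi> (inv h) ` {x \<in> S. F x = \<phi> \<eta> x} \<subseteq> {x \<in> S. F x = \<phi> \<gamma> x}"
      using h by (auto simp: S inv simp flip: *)
  qed (use h in \<open>auto simp: S inv *\<close>)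
  then show ?thesis
    by (rule bij_betw_same_card)
qed

section \<open>Twisted conjugacy classes\<close>

text \<open>Since \<open>\<theta>\<close> is a homomorphism, sending \<open>\<gamma>\<close> to
  \<open>\<theta> h \<otimes> \<gamma> \<otimes> inv h\<close> is an action of the group on its own
  carrier, and the relation is that of lying in one orbit.\<close>

lemma (in group) equiv_twisted_conj:
  assumes "\<theta> \<in> hom G G"
  shows "equiv (carrier G) (twisted_conj G \<theta>)"
proof -
  interpret group_hom G G \<theta>
    using assms by unfold_locales
  show ?thesis
  proof (rule equivI)
    show "twisted_conj G \<theta> \<subseteq> carrier G \<times> carrier G"
      by (auto simp: twisted_conj_def)
    show "refl_on (carrier G) (twisted_conj G \<theta>)"
      by (rule refl_onI) (auto simp: twisted_conj_def intro!: bexI[of _ \<one>])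
    show "sym (twisted_conj G \<theta>)"
    proof (rule symI)
      fix \<gamma> \<eta>
      assume "(\<gamma>, \<eta>) \<in> twisted_conj G \<theta>"
      then obtain h where h: "h \<in> carrier G" "\<gamma> \<in> carrier G" "\<eta> \<in> carrier G"
          "\<eta> = \<theta> h \<otimes> \<gamma> \<otimes> inv h"
        by (auto simp: twisted_conj_def)
      then have "\<theta> (inv h) \<otimes> \<eta> \<otimes> inv (inv h) = \<gamma>"
        by (simp add: m_assoc inv_solve_left')
      then show "(\<eta>, \<gamma>) \<in> twisted_conj G \<theta>"
        using h by (auto simp: twisted_conj_def intro!: bexI[of _ "inv h"])
    qed
    show "trans (twisted_conj G \<theta>)"
    proof (rule transI)
      fix \<beta> \<gamma> \<eta>
      assume "(\<beta>, \<gamma>) \<in> twisted_conj G \<theta>" "(\<gamma>, \<eta>) \<in> twisted_conj G \<theta>"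
      then obtain h k where hk: "h \<in> carrier G" "k \<in> carrier G" "\<beta> \<in> carrier G" "\<eta> \<in> carrier G"
          "\<eta> = \<theta> k \<otimes> (\<theta> h \<otimes> \<beta> \<otimes> inv h) \<otimes> inv k"
        by (auto simp: twisted_conj_def)
      then have "\<eta> = \<theta> (k \<otimes> h) \<otimes> \<beta> \<otimes> inv (k \<otimes> h)"
        by (simp add: m_assoc inv_mult_group)
      then show "(\<beta>, \<eta>) \<in> twisted_conj G \<theta>"
        using hk by (auto simp: twisted_conj_def intro!: bexI[of _ "k \<otimes> h"])
    qed
  qed
qed

text \<open>The classes of the representatives partition \<open>A\<close>, and \<open>f\<close> is
  constant on each, so a class contributes its size times the value at its representative.\<close>

lemma sum_complete_reps:
  fixes f :: "'i \<Rightarrow> 'c::comm_semiring_1"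
  assumes r: "equiv A r" and "finite A" and R: "complete_reps A r R"
    and f: "\<And>x y. (x, y) \<in> r \<Longrightarrow> f x = f y"
  shows "(\<Sum>x\<in>R. of_nat (card (r `` {x})) * f x) = (\<Sum>x\<in>A. f x)"
proof -
  have RA: "R \<subseteq> A" and R1: "\<And>C. C \<in> A // r \<Longrightarrow> \<exists>!x. x \<in> R \<inter> C"
    using R by (auto simp: complete_reps_def)
  have sub: "r `` {x} \<subseteq> A" for x
    using r by (auto simp: equiv_def refl_on_def)
  \<comment> \<open>Two related representatives both lie in the class of \<open>x\<close>, which
    contains only one.\<close>
  have uniq: "x = y" if "x \<in> R" "y \<in> R" "(x, y) \<in> r" for x y
  proof -
    have "x \<in> r `` {x}"
      using r RA that by (meson equiv_class_self subsetD)
    then show ?thesis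
      using R1[of "r `` {x}"] RA that quotientI[of x A r] by blast
  qed
  have disj: "r `` {x} \<inter> r `` {y} = {}" if "x \<in> R" "y \<in> R" "x \<noteq> y" for x y
    using uniq that r by (metis disjoint_iff Image_singleton_iff equivE symE transE)
  have "A \<subseteq> (\<Union>x\<in>R. r `` {x})"
  proof
    fix a
    assume "a \<in> A"
    then obtain x where "x \<in> R" "(a, x) \<in> r"
      using R1[of "r `` {a}"] by (auto simp: quotientI)
    then show "a \<in> (\<Union>x\<in>R. r `` {x})"
      using r by (auto elim: equivE dest: symD)
  qed
  then have A: "A = (\<Union>x\<in>R. r `` {x})"
    using sub by blast
  have "(\<Sum>x\<in>R. of_nat (card (r `` {x})) * f x) = (\<Sum>x\<in>R. \<Sum>y\<in>r `` {x}. f y)"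
    using f by (intro sum.cong refl) (simp add: Image_def flip: f)
  also have "\<dots> = (\<Sum>y\<in>(\<Union>x\<in>R. r `` {x}). f y)"
    using \<open>finite A\<close> RA sub disj
    by (intro sum.UNION_disjoint[symmetric]) (auto intro: finite_subset)
  finally show ?thesis
    using A by simp
qed

section \<open>Conjugation by Frobenius and the induced automorphism of the group\<close>

text \<open>Eliminates the inverse of Frobenius from \<open>frob_conj\<close>: as every point of
  \<open>V\<close> has the form \<open>frob P\<close> with \<open>P\<close> in \<open>V\<close>,
  this determines the conjugate on all of \<open>V\<close>.\<close>

lemma frob_conj_frob:
  assumes "bij_betw frob V V" "P \<in> V"
  shows "frob_conj V \<sigma> (frob P) = frob (\<sigma> P)"
  using assms bij_betw_apply[OF assms] by (simp add: frob_conj_def bij_betw_def inv_into_f_f)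

lemma frob_conj_Bij:
  assumes V: "bij_betw frob V V" and \<sigma>: "\<sigma> \<in> Bij V"
  shows "frob_conj V \<sigma> \<in> Bij V"
proof -
  have "bij_betw (frob \<circ> (\<sigma> \<circ> inv_into V frob)) V V"
    using V \<sigma> by (intro bij_betw_trans[where B = V] bij_betw_inv_into) (auto simp: Bij_def)
  then have "bij_betw (frob_conj V \<sigma>) V V"
    by (rule iffD1[OF bij_betw_cong, rotated]) (simp add: frob_conj_def)
  then show ?thesis
    by (simp add: Bij_def frob_conj_def)
qed

lemma frob_conj_compose:
  assumes V: "bij_betw frob V V" and \<sigma>: "\<sigma> \<in> Bij V" and \<tau>: "\<tau> \<in> Bij V"
  shows "frob_conj V (compose V \<sigma> \<tau>) = compose V (frob_conj V \<sigma>) (frob_conj V \<tau>)"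
proof (rule extensionalityI[where A = V])
  fix P
  assume "P \<in> V"
  then obtain R where R: "R \<in> V" "P = frob R"
    using V by (auto simp: bij_betw_def)
  then show "frob_conj V (compose V \<sigma> \<tau>) P = compose V (frob_conj V \<sigma>) (frob_conj V \<tau>) P"
    using \<open>P \<in> V\<close> \<tau> V by (simp add: compose_eq frob_conj_frob Bij_imp_funcset[THEN Pi_mem])
qed (simp_all add: frob_conj_def)

lemma inj_on_frob_conj:
  assumes V: "bij_betw frob V V"
  shows "inj_on (frob_conj V) (Bij V)"
proof (rule inj_onI)
  fix \<sigma> \<tau>
  assume *: "\<sigma> \<in> Bij V" "\<tau> \<in> Bij V" "frob_conj V \<sigma> = frob_conj V \<tau>"
  show "\<sigma> = \<tau>"
  proof (rule extensionalityI[where A = V])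
    fix P
    assume "P \<in> V"
    then have "frob (\<sigma> P) = frob (\<tau> P)"
      using * frob_conj_frob[OF V] by metis
    then show "\<sigma> P = \<tau> P"
      using inj_frob by (rule injD[rotated])
  qed (use * in \<open>auto simp: Bij_def\<close>)
qed

text \<open>Justifies the definite description in \<open>frob_twist\<close>. Stability puts each
  conjugate back into the image of the group, and faithfulness makes its preimage unique, so
  conjugation transports to the group.\<close>

lemma frob_twist_auto:
  fixes V :: "(nat \<Rightarrow> 'a::{field,finite} alg_closure) set"
  assumes "faithful_action G V \<phi>" and V: "bij_betw frob V V" and stable: "frob_stable V G \<phi>"
  shows "frob_twist V G \<phi> \<in> auto G \<and>
    (\<forall>g\<in>carrier G. \<phi> (frob_twist V G \<phi> g) = frob_conj V (\<phi> g))"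
proof -
  interpret faithful_action G V \<phi> by fact
  interpret G: group G
    using group_hom by (simp add: group_hom_def)
  \<comment> \<open>The restriction to the carrier makes \<open>\<theta>\<close> extensional, as
    membership in \<open>auto G\<close> demands.\<close>
  define \<theta> where "\<theta> = (\<lambda>g\<in>carrier G. inv_into (carrier G) \<phi> (frob_conj V (\<phi> g)))"
  have \<phi>_mult: "\<phi> (g \<otimes>\<^bsub>G\<^esub> h) = compose V (\<phi> g) (\<phi> h)" if "g \<in> carrier G" "h \<in> carrier G" for g h
    using that group_hom.hom_mult[OF group_hom] bij_prop0 by (simp add: BijGroup_def)
  have \<theta>: "\<theta> g \<in> carrier G" "\<phi> (\<theta> g) = frob_conj V (\<phi> g)" if "g \<in> carrier G" for g
  proof -
    have "frob_conj V (\<phi> g) \<in> \<phi> ` carrier G"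
      using stable that by (auto simp: frob_stable_def)
    then show "\<theta> g \<in> carrier G" "\<phi> (\<theta> g) = frob_conj V (\<phi> g)"
      using that by (simp_all add: \<theta>_def inv_into_into f_inv_into_f)
  qed
  have "\<theta> \<in> hom G G"
  proof (rule homI)
    fix g h
    assume gh: "g \<in> carrier G" "h \<in> carrier G"
    then have "\<phi> (\<theta> (g \<otimes>\<^bsub>G\<^esub> h)) = \<phi> (\<theta> g \<otimes>\<^bsub>G\<^esub> \<theta> h)"
      by (simp add: \<theta> \<phi>_mult frob_conj_compose V bij_prop0)
    then show "\<theta> (g \<otimes>\<^bsub>G\<^esub> h) = \<theta> g \<otimes>\<^bsub>G\<^esub> \<theta> h"
      using gh \<theta>(1) by (intro inj_onD[OF faithful]) simp_all
  qed (simp add: \<theta>)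
  moreover have "\<theta> \<in> Bij (carrier G)"
  proof -
    have "inj_on \<theta> (carrier G)"
    proof (rule inj_onI)
      fix g h
      assume gh: "g \<in> carrier G" "h \<in> carrier G" "\<theta> g = \<theta> h"
      then have "frob_conj V (\<phi> g) = frob_conj V (\<phi> h)"
        using \<theta> by metis
      then have "\<phi> g = \<phi> h"
        using gh(1,2) bij_prop0 inj_on_frob_conj[OF V] by (meson inj_onD)
      then show "g = h"
        using gh(1,2) faithful by (meson inj_onD)
    qed
    moreover have "\<theta> ` carrier G = carrier G"
    proof (intro equalityI subsetI)
      fix g
      assume g: "g \<in> carrier G"
      \<comment> \<open>Surjectivity uses the other half of stability: every acting map is itself a
        conjugate.\<close>
      then obtain h where h: "h \<in> carrier G" "\<phi> g = frob_conj V (\<phi> h)"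
        using stable by (auto simp: frob_stable_def)
      then have "\<theta> h = g"
        using g \<theta> faithful by (metis inj_onD)
      then show "g \<in> \<theta> ` carrier G"
        using h by blast
    qed (use \<theta> in auto)
    ultimately show ?thesis
      by (simp add: Bij_def bij_betw_def \<theta>_def)
  qed
  ultimately have ex: "\<theta> \<in> auto G \<and> (\<forall>g\<in>carrier G. \<phi> (\<theta> g) = frob_conj V (\<phi> g))"
    using \<theta> by (simp add: auto_def)
  have unique: "\<theta>' = \<theta>"
    if \<theta>': "\<theta>' \<in> auto G \<and> (\<forall>g\<in>carrier G. \<phi> (\<theta>' g) = frob_conj V (\<phi> g))" for \<theta>'
  proof (rule extensionalityI[where A = "carrier G"])
    fix g
    assume "g \<in> carrier G"
    then show "\<theta>' g = \<theta> g"
      using \<theta> \<theta>' faithful by (auto simp: auto_def hom_def Pi_def inj_on_def)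
  qed (use \<theta>' in \<open>auto simp: auto_def Bij_def \<theta>_def\<close>)
  show ?thesis
    unfolding frob_twist_def by (rule theI[where a = \<theta>]) (fact ex, fact unique)
qed

section \<open>The fibre of the quotient map over a rational point\<close>

theorem proposition3p4:
  fixes W :: "'a::{field,finite} weierstrass"
    and E Y :: "(nat \<Rightarrow> 'a alg_closure) set"
    and \<Lambda> :: "('g, 'm) monoid_scheme"
    and act :: "'g \<Rightarrow> (nat \<Rightarrow> 'a alg_closure) \<Rightarrow> (nat \<Rightarrow> 'a alg_closure)"
    and \<pi> :: "(nat \<Rightarrow> 'a alg_closure) \<Rightarrow> (nat \<Rightarrow> 'a alg_closure)"
    and n :: nat
    and P Q :: "nat \<Rightarrow> 'a alg_closure"
    and \<theta> :: "'g \<Rightarrow> 'g"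
  assumes "elliptic_curve W"
    and "E = ec_points (base_change W)"
    and "finite (carrier \<Lambda>)"
    and "faithful_action \<Lambda> E act"
    and "act ` carrier \<Lambda> \<subseteq> ec_automorphisms (base_change W)"
    and "frob_stable E \<Lambda> act"
    and "linear_part (base_change W) ` act ` carrier \<Lambda> \<noteq> {\<lambda>P\<in>E. P}"
    and "algebraic_set (range to_ac) n Y"
    and "proj_morphism (range to_ac) 2 E n Y \<pi>"
    and "geometric_quotient 2 E \<Lambda> act n Y \<pi>"
    and "\<theta> = frob_twist E \<Lambda> act"
    and "Q \<in> rational_points Y"
    and "P \<in> fibre E \<pi> Q"
  shows "(\<forall>R \<in> fibre E \<pi> Q.
            card {\<gamma> \<in> carrier \<Lambda>. R \<in> frob_points E act \<gamma>} = card (stabilizer \<Lambda> act P)) \<and>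
         (\<Sum>\<gamma>\<in>carrier \<Lambda>. fibre_count E act \<pi> Q \<gamma>) = card (carrier \<Lambda>) \<and>
         (\<forall>(\<gamma>, \<eta>) \<in> twisted_conj \<Lambda> \<theta>. fibre_count E act \<pi> Q \<gamma> = fibre_count E act \<pi> Q \<eta>) \<and>
         (\<forall>R. complete_reps (carrier \<Lambda>) (twisted_conj \<Lambda> \<theta>) R \<longrightarrow>
            (\<Sum>\<gamma>\<in>R. card (twisted_conj \<Lambda> \<theta> `` {\<gamma>}) * fibre_count E act \<pi> Q \<gamma>) = card (carrier \<Lambda>))"
proof -
  interpret faithful_action \<Lambda> E act by fact
  interpret G: group \<Lambda>
    using group_hom by (simp add: group_hom_def)
  have frob_E: "bij_betw frob E E"
    using assms(2) bij_betw_frob_ec_points by simp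
  have twist: "\<theta> \<in> auto \<Lambda>" "\<And>\<gamma>. \<gamma> \<in> carrier \<Lambda> \<Longrightarrow> act (\<theta> \<gamma>) = frob_conj E (act \<gamma>)"
    using frob_twist_auto[OF assms(4) frob_E assms(6)] assms(11) by auto
  have P: "P \<in> E" "\<pi> P = Q"
    using assms(13) by (auto simp: fibre_def)
  have "fibre E \<pi> (\<pi> P) = orbit \<Lambda> act P"
    using assms(10) P(1) unfolding geometric_quotient_def fibre_def by blast
  then have fib: "fibre E \<pi> Q = orbit \<Lambda> act P"
    using P by simp
  have "Y \<subseteq> proj_space n"
    using assms(8) by (auto simp: algebraic_set_def)
  \<comment> \<open>The quotient map commutes with Frobenius, and \<open>Q\<close> is fixed by it,
    so \<open>\<pi> (frob R) = frob (\<pi> R) = Q\<close>.\<close>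
  then have frob_fib: "frob R \<in> orbit \<Lambda> act P" if "R \<in> orbit \<Lambda> act P" for R
    using that bij_betw_apply[OF frob_E] proj_morphism_frob[OF assms(9)]
      frob_rational_points[OF assms(12)] by (simp add: fibre_def flip: fib)
  \<comment> \<open>Puts the counts into the form of coincidences of \<open>frob\<close> with the
    action on one orbit.\<close>
  have count: "fibre_count E act \<pi> Q = (\<lambda>\<gamma>. card {R \<in> orbit \<Lambda> act P. frob R = act \<gamma> R})"
    unfolding fibre_count_def frob_points_def fib[symmetric] fibre_def
    by (intro ext arg_cong[where f = card]) blast

  have "card {\<gamma> \<in> carrier \<Lambda>. R \<in> frob_points E act \<gamma>} = card (stabilizer \<Lambda> act P)"
    if R: "R \<in> fibre E \<pi> Q" for R
  proof -
    \<comment> \<open>The elements counted form the transporter from \<open>R\<close> to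
      \<open>frob R\<close>, which lies in the orbit of \<open>R\<close> because the fibre is a
      single orbit.\<close>
    have "R \<in> E" "R \<in> orbit \<Lambda> act P" "frob R \<in> orbit \<Lambda> act R"
      using R fib frob_fib orbit_eq[OF P(1)] by (auto simp: fibre_def)
    then show ?thesis
      using card_transporter[of R "frob R"] card_stabilizer_orbit[OF assms(3) P(1)]
      by (simp add: frob_points_def eq_commute)
  qed
  moreover have total: "(\<Sum>\<gamma>\<in>carrier \<Lambda>. fibre_count E act \<pi> Q \<gamma>) = card (carrier \<Lambda>)"
    unfolding count using assms(3) P(1) frob_fib by (rule sum_card_coincidences)
  moreover have const: "fibre_count E act \<pi> Q \<gamma> = fibre_count E act \<pi> Q \<eta>"
    if "(\<gamma>, \<eta>) \<in> twisted_conj \<Lambda> \<theta>" for \<gamma> \<eta>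
    unfolding count
  proof (rule card_coincidences_twisted_conj[OF _ _ _ _ _ that])
    show "\<theta> \<in> carrier \<Lambda> \<rightarrow> carrier \<Lambda>"
      using twist(1) by (simp add: auto_def hom_def)
    show "frob \<in> E \<rightarrow> E"
      using frob_E by (rule bij_betw_imp_funcset)
    show "orbit \<Lambda> act P \<subseteq> E"
      unfolding fib[symmetric] by (auto simp: fibre_def)
    show "act \<gamma> R \<in> orbit \<Lambda> act P" if "\<gamma> \<in> carrier \<Lambda>" "R \<in> orbit \<Lambda> act P" for \<gamma> R
      using that orbit_eq[OF P(1), of R] by (auto simp: orbit_def)
    show "frob (act \<gamma> R) = act (\<theta> \<gamma>) (frob R)" if "\<gamma> \<in> carrier \<Lambda>" "R \<in> E" for \<gamma> R
      using that twist(2) frob_conj_frob[OF frob_E] by simp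
  qed
  moreover have "(\<Sum>\<gamma>\<in>R. card (twisted_conj \<Lambda> \<theta> `` {\<gamma>}) * fibre_count E act \<pi> Q \<gamma>) = card (carrier \<Lambda>)"
    if R: "complete_reps (carrier \<Lambda>) (twisted_conj \<Lambda> \<theta>) R" for R
    using sum_complete_reps[OF G.equiv_twisted_conj assms(3) R const] twist(1) total
    by (simp add: auto_def)
  ultimately show ?thesis
    by blast
qed

end
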